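(* Let $(\phi^n,\phi^{n+1},\xi^{n+1})$ satisfy one step of the one-dimensional fully-discrete upwind-SAV scheme described in the context. Then, with no restriction on $\Delta t>0$ and $\Delta x>0$, $$\frac{\mathcal{E}^{n+1}-\mathcal{E}^{n}}{\Delta x}\le -\Delta t\sum_{i=1}^{N_x-1}\min\left\{M(\phi_i^{n+1},\phi_{i+1}^{n+1}),\,M(\phi_{i+1}^{n+1},\phi_i^{n+1})\right\}\left|V_{i+\frac12}^{n+1}\right|^2\le 0,$$ where the discrete energy is $$\mathcal{E}^{n}=\Delta x\sum_{i=1}^{N_x-1}\frac{\varepsilon^2}{2}\big|(\nabla\phi)_{i+\frac12}^{n}\big|^2+\Delta x\sum_{i=1}^{N_x}F(\phi_i^n).$$
   Context: Parameters: an integer $N_x\ge 2$ (number of cells), cell size $\Delta x>0$, time step $\Delta t>0$, interface parameter $\varepsilon>0$, a positive integer $k$. The potential $F:I\to\mathbb{R}$ is the free energy density, differentiable on its domain of definition $I\subseteq\mathbb{R}$, an interval; typical choices are the logarithmic Flory--Huggins potential $F(\phi)=\frac{\theta}{2}[(1+\phi)\ln(1+\phi)+(1-\phi)\ln(1-\phi)]+\frac{\theta_c}{2}(1-\phi^2)$ with $0<\theta<\theta_c$ (differentiable on $I=(-1,1)$), or the polynomial potential $F(\phi)=\frac14(1-\phi^2)^2$ (with $I=\mathbb{R}$). Notation: $\chi^+=\max\{\chi,0\}$, $\chi^-=\min\{\chi,0\}$, and the mobility is $M(\chi_1,\chi_2)=\big[(1+\chi_1)^+(1-\chi_2)^+\big]^k$.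 Scheme: one step from the cell averages $\phi^n=(\phi_i^n)_{i=1}^{N_x}$ to $\phi^{n+1}=(\phi_i^{n+1})_{i=1}^{N_x}$ and $\xi^{n+1}\in\mathbb{R}$ (all cell averages in $I$) means that the following hold: $$\phi_i^{n+1}-\phi_i^n=-\frac{\Delta t}{\Delta x}\left(J_{i+\frac12}^{n+1}-J_{i-\frac12}^{n+1}\right),\quad 1\le i\le N_x,$$ $$J_{i+\frac12}^{n+1}=\left(V_{i+\frac12}^{n+1}\right)^+M(\phi_i^{n+1},\phi_{i+1}^{n+1})+\left(V_{i+\frac12}^{n+1}\right)^-M(\phi_{i+1}^{n+1},\phi_i^{n+1}),\quad 1\le i\le N_x-1,$$ $$V_{i+\frac12}^{n+1}=-\frac{1}{\Delta x}\left(\mu_{i+1}^{n+1}-\mu_i^{n+1}\right),\quad 1\le i\le N_x-1,$$ $$\mu_i^{n+1}=-\varepsilon^2(\Delta\phi)_i^{n+1}+\xi^{n+1}F'(\phi_i^{n+1}),\quad 1\le i\le N_x,$$ $$\sum_{i=1}^{N_x}\left(F(\phi_i^{n+1})-F(\phi_i^n)\right)=\xi^{n+1}\sum_{i=1}^{N_x}F'(\phi_i^{n+1})(\phi_i^{n+1}-\phi_i^n),$$ where $(\nabla\phi)_{i+\frac12}^{n}=\frac{\phi_{i+1}^{n}-\phi_i^{n}}{\Delta x}$ for $1\le i\le N_x-1$, $(\nabla\phi)_{\frac12}^{n}=(\nabla\phi)_{N_x+\frac12}^{n}=0$, $(\Delta\phi)_i^{n+1}=\frac{(\nabla\phi)_{i+\frac12}^{n+1}-(\nabla\phi)_{i-\frac12}^{n+1}}{\Delta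 x}$ for $1\le i\le N_x$, and the no-flux boundary conditions are $J_{\frac12}^{n+1}=J_{N_x+\frac12}^{n+1}=0$. *)

theory Defs
  imports "HOL-Analysis.Analysis"
begin

text \<open>
  Cell averages are functions \<open>\<phi> :: nat \<Rightarrow> real\<close> of which only the values at
  \<open>1, \<dots>, N\<close> matter. A quantity living on the interface \<open>i + 1/2\<close> is indexed by \<open>i\<close>,
  so the value at \<open>i - 1/2\<close> has index \<open>i - 1\<close>, and the two boundary interfaces
  \<open>1/2\<close> and \<open>N + 1/2\<close> have the indices \<open>0\<close> and \<open>N\<close>.
\<close>

definition pos_part :: "real \<Rightarrow> real" where
  "pos_part x = max x 0"

text \<open>The negative part is nonpositive: \<open>x = pos_part x + neg_part x\<close>.\<close>

definition neg_part :: "real \<Rightarrow> real" where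
  "neg_part x = min x 0"

definition mobility :: "nat \<Rightarrow> real \<Rightarrow> real \<Rightarrow> real" where
  "mobility k x y = (pos_part (1 + x) * pos_part (1 - y)) ^ k"

definition grad :: "nat \<Rightarrow> real \<Rightarrow> (nat \<Rightarrow> real) \<Rightarrow> nat \<Rightarrow> real" where
  "grad N dx \<phi> i = (if 1 \<le> i \<and> i \<le> N - 1 then (\<phi> (i + 1) - \<phi> i) / dx else 0)"

definition lapl :: "nat \<Rightarrow> real \<Rightarrow> (nat \<Rightarrow> real) \<Rightarrow> nat \<Rightarrow> real" where
  "lapl N dx \<phi> i = (grad N dx \<phi> i - grad N dx \<phi> (i - 1)) / dx"

text \<open>The argument \<open>F'\<close> stands for the derivative of the free energy density.\<close>

definition chem_pot ::
    "nat \<Rightarrow> real \<Rightarrow> real \<Rightarrow> (real \<Rightarrow> real) \<Rightarrow> (nat \<Rightarrow> real) \<Rightarrow> real \<Rightarrow> nat \<Rightarrow> real" where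
  "chem_pot N dx \<epsilon> F' \<phi> \<xi> i = - \<epsilon>\<^sup>2 * lapl N dx \<phi> i + \<xi> * F' (\<phi> i)"

definition velocity ::
    "nat \<Rightarrow> real \<Rightarrow> real \<Rightarrow> (real \<Rightarrow> real) \<Rightarrow> (nat \<Rightarrow> real) \<Rightarrow> real \<Rightarrow> nat \<Rightarrow> real" where
  "velocity N dx \<epsilon> F' \<phi> \<xi> i =
     - (1 / dx) * (chem_pot N dx \<epsilon> F' \<phi> \<xi> (i + 1) - chem_pot N dx \<epsilon> F' \<phi> \<xi> i)"

text \<open>The value \<open>0\<close> outside the interior interfaces is the no-flux boundary condition.\<close>

definition flux ::
    "nat \<Rightarrow> real \<Rightarrow> real \<Rightarrow> nat \<Rightarrow> (real \<Rightarrow> real) \<Rightarrow> (nat \<Rightarrow> real) \<Rightarrow> real \<Rightarrow> nat \<Rightarrow> real" where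
  "flux N dx \<epsilon> k F' \<phi> \<xi> i =
     (if 1 \<le> i \<and> i \<le> N - 1
      then pos_part (velocity N dx \<epsilon> F' \<phi> \<xi> i) * mobility k (\<phi> i) (\<phi> (i + 1))
         + neg_part (velocity N dx \<epsilon> F' \<phi> \<xi> i) * mobility k (\<phi> (i + 1)) (\<phi> i)
      else 0)"

text \<open>One step from \<open>\<phi>\<close> to \<open>(\<psi>, \<xi>)\<close>; all fluxes are taken at the new time level.\<close>

definition upwind_sav_step ::
    "nat \<Rightarrow> real \<Rightarrow> real \<Rightarrow> real \<Rightarrow> nat \<Rightarrow> real set \<Rightarrow> (real \<Rightarrow> real) \<Rightarrow> (real \<Rightarrow> real)
      \<Rightarrow> (nat \<Rightarrow> real) \<Rightarrow> (nat \<Rightarrow> real) \<Rightarrow> real \<Rightarrow> bool" where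
  "upwind_sav_step N dx dt \<epsilon> k I F F' \<phi> \<psi> \<xi> \<longleftrightarrow>
     (\<forall>i\<in>{1..N}. \<phi> i \<in> I \<and> \<psi> i \<in> I) \<and>
     (\<forall>i\<in>{1..N}. \<psi> i - \<phi> i =
        - (dt / dx) * (flux N dx \<epsilon> k F' \<psi> \<xi> i - flux N dx \<epsilon> k F' \<psi> \<xi> (i - 1))) \<and>
     (\<Sum>i=1..N. F (\<psi> i) - F (\<phi> i)) = \<xi> * (\<Sum>i=1..N. F' (\<psi> i) * (\<psi> i - \<phi> i))"

definition discrete_energy ::
    "nat \<Rightarrow> real \<Rightarrow> real \<Rightarrow> (real \<Rightarrow> real) \<Rightarrow> (nat \<Rightarrow> real) \<Rightarrow> real" where
  "discrete_energy N dx \<epsilon> F \<phi> =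
     dx * (\<Sum>i=1..N-1. \<epsilon>\<^sup>2 / 2 * \<bar>grad N dx \<phi> i\<bar>\<^sup>2) + dx * (\<Sum>i=1..N. F (\<phi> i))"

end

theory Submission
  imports Defs
begin

text \<open>
  Test the mass balance with the new chemical potential \<open>\<mu>\<close>. Summation by parts under no-flux
  conditions turns the transport side into \<open>- dt * \<Sum> J * V\<close>, and upwinding gives
  \<open>J * V \<ge> min M * V\<^sup>2\<close> at each interface. On the other side the gradient part of \<open>\<mu>\<close>
  contributes \<open>\<epsilon>\<^sup>2 * \<Sum> a * (a - b)\<close> with \<open>a\<close>, \<open>b\<close> the new and old gradients, which dominates
  \<open>\<epsilon>\<^sup>2 / 2 * \<Sum> (a\<^sup>2 - b\<^sup>2)\<close>, and the scalar auxiliary variable \<open>\<xi>\<close> is chosen precisely so that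
  the potential part of \<open>\<mu>\<close> contributes the exact increment of \<open>\<Sum> F\<close>.
\<close>

lemma summation_by_parts:
  fixes g a :: "nat \<Rightarrow> 'a::comm_ring"
  shows "(\<Sum>i=1..Suc n. (g i - g (i - 1)) * a i) =
    g (Suc n) * a (Suc n) - g 0 * a 1 - (\<Sum>i=1..n. g i * (a (i + 1) - a i))"
  by (induction n) (simp_all add: algebra_simps)

text \<open>Both \<open>grad\<close> and \<open>flux\<close> are defined to be 0 at the boundary
  interfaces 0 and \<open>N\<close>, so the boundary terms drop out in both applications.\<close>

lemma summation_by_parts_zero_boundary:
  fixes g a :: "nat \<Rightarrow> 'a::comm_ring"
  assumes "g 0 = 0" and "g N = 0" and "N \<ge> 1"
  shows "(\<Sum>i=1..N. (g i - g (i - 1)) * a i) = - (\<Sum>i=1..N-1. g i * (a (i + 1) - a i))"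
  using summation_by_parts[of g a "N - 1"] assms by simp

lemma mobility_nonneg: "mobility k x y \<ge> 0"
  by (simp add: mobility_def pos_part_def)

text \<open>At most one of the two parts of \<open>v\<close> is nonzero; it then equals
  \<open>v\<close>, and the weight that survives is at least the minimum.\<close>

lemma min_times_square_le_upwind:
  fixes v p q :: real
  shows "min p q * v\<^sup>2 \<le> (pos_part v * p + neg_part v * q) * v"
proof (cases "v \<ge> 0")
  case True
  then show ?thesis
    using mult_right_mono[of "min p q" p "v\<^sup>2"]
    by (simp add: pos_part_def neg_part_def power2_eq_square mult_ac)
next
  case False
  then show ?thesis
    using mult_right_mono[of "min p q" q "v\<^sup>2"]
    by (simp add: pos_part_def neg_part_def power2_eq_square mult_ac)
qed

text \<open>The gap between the two sides is \<open>(a - b)\<^sup>2 / 2\<close>, the numerical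
  dissipation of the implicit gradient term.\<close>

lemma half_diff_squares_le:
  fixes a b :: real
  shows "(a\<^sup>2 - b\<^sup>2) / 2 \<le> a * (a - b)"
  using zero_le_power2[of "a - b"] by (simp add: power2_eq_square field_simps)

lemma sum_lapl_mult:
  assumes "N \<ge> 1"
  shows "(\<Sum>i=1..N. lapl N dx \<psi> i * (\<psi> i - \<phi> i)) =
    - (\<Sum>i=1..N-1. grad N dx \<psi> i * (grad N dx \<psi> i - grad N dx \<phi> i))"
proof -
  \<comment> \<open>The factor \<open>1 / dx\<close> of the Laplacian moves to the test function,
    whose forward differences then become differences of gradients.\<close>
  have "(\<Sum>i=1..N. lapl N dx \<psi> i * (\<psi> i - \<phi> i)) =
      (\<Sum>i=1..N. (grad N dx \<psi> i - grad N dx \<psi> (i - 1)) * ((\<psi> i - \<phi> i) / dx))"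
    by (simp add: lapl_def)
  also have "\<dots> = - (\<Sum>i=1..N-1. grad N dx \<psi> i *
      ((\<psi> (i + 1) - \<phi> (i + 1)) / dx - (\<psi> i - \<phi> i) / dx))"
    using assms by (intro summation_by_parts_zero_boundary) (auto simp: grad_def)
  also have "\<dots> = - (\<Sum>i=1..N-1. grad N dx \<psi> i * (grad N dx \<psi> i - grad N dx \<phi> i))"
    by (intro arg_cong[where f = uminus] sum.cong arg_cong2[where f = "(*)"] refl)
      (auto simp: grad_def diff_divide_distrib)
  finally show ?thesis .
qed

text \<open>The velocity is minus the difference quotient of the chemical potential: its sign
  cancels the one from summation by parts, and a factor \<open>dx\<close> remains.\<close>

lemma sum_flux_diff_chem_pot:
  assumes "N \<ge> 1" and "dx \<noteq> 0"
  shows "(\<Sum>i=1..N. (flux N dx \<epsilon> k F' \<psi> \<xi> i - flux N dx \<epsilon> k F' \<psi> \<xi> (i - 1))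
      * chem_pot N dx \<epsilon> F' \<psi> \<xi> i) =
    dx * (\<Sum>i=1..N-1. flux N dx \<epsilon> k F' \<psi> \<xi> i * velocity N dx \<epsilon> F' \<psi> \<xi> i)"
proof -
  have "(\<Sum>i=1..N. (flux N dx \<epsilon> k F' \<psi> \<xi> i - flux N dx \<epsilon> k F' \<psi> \<xi> (i - 1))
      * chem_pot N dx \<epsilon> F' \<psi> \<xi> i) =
    - (\<Sum>i=1..N-1. flux N dx \<epsilon> k F' \<psi> \<xi> i *
        (chem_pot N dx \<epsilon> F' \<psi> \<xi> (i + 1) - chem_pot N dx \<epsilon> F' \<psi> \<xi> i))"
    using assms by (intro summation_by_parts_zero_boundary) (auto simp: flux_def)
  also have "\<dots> = dx * (\<Sum>i=1..N-1. flux N dx \<epsilon> k F' \<psi> \<xi> i * velocity N dx \<epsilon> F' \<psi> \<xi> i)"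
    unfolding sum_distrib_left sum_negf[symmetric] velocity_def
    using assms by (intro sum.cong refl) (simp add: field_simps)
  finally show ?thesis .
qed

lemma min_mobility_le_flux:
  assumes "i \<in> {1..N-1}"
  shows "min (mobility k (\<psi> i) (\<psi> (i + 1))) (mobility k (\<psi> (i + 1)) (\<psi> i))
      * \<bar>velocity N dx \<epsilon> F' \<psi> \<xi> i\<bar>\<^sup>2
    \<le> flux N dx \<epsilon> k F' \<psi> \<xi> i * velocity N dx \<epsilon> F' \<psi> \<xi> i"
  using assms min_times_square_le_upwind by (simp add: flux_def)

lemma discrete_energy_diff_le:
  assumes "N \<ge> 1" and "dx > 0"
    and sav: "(\<Sum>i=1..N. F (\<psi> i) - F (\<phi> i)) = \<xi> * (\<Sum>i=1..N. F' (\<psi> i) * (\<psi> i - \<phi> i))"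
  shows "(discrete_energy N dx \<epsilon> F \<psi> - discrete_energy N dx \<epsilon> F \<phi>) / dx
    \<le> (\<Sum>i=1..N. chem_pot N dx \<epsilon> F' \<psi> \<xi> i * (\<psi> i - \<phi> i))"
proof -
  have energy: "discrete_energy N dx \<epsilon> F u / dx =
      \<epsilon>\<^sup>2 * (\<Sum>i=1..N-1. (grad N dx u i)\<^sup>2 / 2) + (\<Sum>i=1..N. F (u i))" for u
    using assms(2)
    by (simp add: discrete_energy_def add_divide_distrib sum_distrib_left[of "\<epsilon>\<^sup>2"])
  let ?a = "grad N dx \<psi>" and ?b = "grad N dx \<phi>"
  have "(discrete_energy N dx \<epsilon> F \<psi> - discrete_energy N dx \<epsilon> F \<phi>) / dx =
      \<epsilon>\<^sup>2 * (\<Sum>i=1..N-1. ((?a i)\<^sup>2 - (?b i)\<^sup>2) / 2) + (\<Sum>i=1..N. F (\<psi> i) - F (\<phi> i))"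
    unfolding diff_divide_distrib energy sum_subtractf by (simp add: right_diff_distrib)
  \<comment> \<open>The only inequality of the chain: the increment of \<open>F\<close> is carried
    along unchanged and then replaced exactly through \<open>sav\<close>.\<close>
  also have "\<dots> \<le> \<epsilon>\<^sup>2 * (\<Sum>i=1..N-1. ?a i * (?a i - ?b i)) + (\<Sum>i=1..N. F (\<psi> i) - F (\<phi> i))"
    by (intro add_right_mono mult_left_mono sum_mono half_diff_squares_le) simp
  also have "\<dots> = - \<epsilon>\<^sup>2 * (\<Sum>i=1..N. lapl N dx \<psi> i * (\<psi> i - \<phi> i))
      + \<xi> * (\<Sum>i=1..N. F' (\<psi> i) * (\<psi> i - \<phi> i))"
    using sum_lapl_mult[OF assms(1), of dx \<psi> \<phi>] sav by simp
  also have "\<dots> = (\<Sum>i=1..N. chem_pot N dx \<epsilon> F' \<psi> \<xi> i * (\<psi> i - \<phi> i))"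
    unfolding sum_distrib_left sum.distrib[symmetric] chem_pot_def
    by (intro sum.cong refl) (simp add: algebra_simps)
  finally show ?thesis .
qed

theorem theorem3:
  fixes N k :: nat and dx dt \<epsilon> \<xi> :: real and I :: "real set"
    and F F' :: "real \<Rightarrow> real" and \<phi> \<psi> :: "nat \<Rightarrow> real"
  assumes "N \<ge> 2" and "dx > 0" and "dt > 0" and "\<epsilon> > 0" and "k > 0"
    and "is_interval I"
    and "\<And>x. x \<in> I \<Longrightarrow> (F has_real_derivative F' x) (at x within I)"
    and "upwind_sav_step N dx dt \<epsilon> k I F F' \<phi> \<psi> \<xi>"
  shows "(discrete_energy N dx \<epsilon> F \<psi> - discrete_energy N dx \<epsilon> F \<phi>) / dx
           \<le> - dt * (\<Sum>i=1..N-1. min (mobility k (\<psi> i) (\<psi> (i + 1))) (mobility k (\<psi> (i + 1)) (\<psi> i))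
                                * \<bar>velocity N dx \<epsilon> F' \<psi> \<xi> i\<bar>\<^sup>2)
       \<and> - dt * (\<Sum>i=1..N-1. min (mobility k (\<psi> i) (\<psi> (i + 1))) (mobility k (\<psi> (i + 1)) (\<psi> i))
                                * \<bar>velocity N dx \<epsilon> F' \<psi> \<xi> i\<bar>\<^sup>2) \<le> 0"
proof
  let ?J = "flux N dx \<epsilon> k F' \<psi> \<xi>" and ?V = "velocity N dx \<epsilon> F' \<psi> \<xi>"
    and ?\<mu> = "chem_pot N dx \<epsilon> F' \<psi> \<xi>"
    and ?m = "\<lambda>i. min (mobility k (\<psi> i) (\<psi> (i + 1))) (mobility k (\<psi> (i + 1)) (\<psi> i))"
  have balance: "\<psi> i - \<phi> i = - (dt / dx) * (?J i - ?J (i - 1))" if "i \<in> {1..N}" for i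
    using assms(8) that unfolding upwind_sav_step_def by blast
  have "(discrete_energy N dx \<epsilon> F \<psi> - discrete_energy N dx \<epsilon> F \<phi>) / dx
      \<le> (\<Sum>i=1..N. ?\<mu> i * (\<psi> i - \<phi> i))"
    using assms(1,2,8) by (intro discrete_energy_diff_le) (auto simp: upwind_sav_step_def)
  also have "\<dots> = - (dt / dx) * (\<Sum>i=1..N. (?J i - ?J (i - 1)) * ?\<mu> i)"
    unfolding sum_distrib_left by (intro sum.cong refl) (simp only: balance mult_ac)
  \<comment> \<open>The factor \<open>dx\<close> from summation by parts cancels the one in
    \<open>dt / dx\<close>.\<close>
  also have "\<dots> = - dt * (\<Sum>i=1..N-1. ?J i * ?V i)"
    using assms(1,2) by (subst sum_flux_diff_chem_pot) auto
  \<comment> \<open>The lower bound at each interface becomes an upper bound because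
    \<open>- dt\<close> is negative.\<close>
  also have "\<dots> \<le> - dt * (\<Sum>i=1..N-1. ?m i * \<bar>?V i\<bar>\<^sup>2)"
    using assms(3) by (intro mult_left_mono_neg sum_mono min_mobility_le_flux) auto
  finally show "(discrete_energy N dx \<epsilon> F \<psi> - discrete_energy N dx \<epsilon> F \<phi>) / dx
      \<le> - dt * (\<Sum>i=1..N-1. ?m i * \<bar>?V i\<bar>\<^sup>2)" .
  show "- dt * (\<Sum>i=1..N-1. ?m i * \<bar>?V i\<bar>\<^sup>2) \<le> 0"
    using assms(3) by (intro mult_nonpos_nonneg sum_nonneg mult_nonneg_nonneg)
      (auto simp: mobility_nonneg)
qed

end
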